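(* Let $A,B,Q,R\in\mathbb{R}$ with $Q$ and $R$ non-negative and $R$ invertible (that is, $Q\ge 0$ and $R>0$), let $T>0$, and set $$\lambda_1=A+\sqrt{A^2+\frac{QB^2}{R}},\qquad \lambda_2=A-\sqrt{A^2+\frac{QB^2}{R}}.$$ Then the solution $\hat\theta$ of the initial value problem $$\hat\theta'(\tau)=-\frac{B^2}{R}\,\hat\theta(\tau)^2+2A\,\hat\theta(\tau)+Q\quad\text{for }\tau\in(0,T),\qquad \hat\theta(0)=0,$$ is given by $$\hat\theta(\tau)=\frac{R}{B^2}\,\lambda_1\lambda_2\,\frac{e^{\lambda_1\tau}-e^{\lambda_2\tau}}{\lambda_2e^{\lambda_1\tau}-\lambda_1e^{\lambda_2\tau}}.$$ As $T\to\infty$ and $\tau\to\infty$ with $\tau<T$, one has $$\hat\theta(\tau)\to\frac{\lambda_1R}{B^2}.$$ Thus the solution of this forward problem converges asymptotically to the solution of the algebraic Riccati equation $$-\frac{B^2}{R}\,\theta^2+2A\,\theta+Q=0$$ that characterizes the optimal solution on the infinite-time horizon.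
   Context: All quantities are real scalars. The initial value problem is the scalar "flipped-sign Riccati equation". It is obtained by the time reversal $\tau=T-s$, $\hat\theta(\tau)=\theta(T-\tau)$, from the Riccati equation $\theta'(s)-\frac{B^2}{R}\theta(s)^2+2A\theta(s)+Q=0$ on $(0,T)$ with terminal condition $\theta(T)=0$. That equation is associated with the scalar linear quadratic control problem with state dynamics $y'=Ay+B\alpha$ (state $y$, control $\alpha$), running cost $\frac12Qy^2+\frac12R\alpha^2$ and zero terminal cost on the horizon $[0,T]$; its value function is $v(x,t)=\frac12\theta(t)x^2$.
   Formalization: B≠0 is assumed, since the formula divides by B². The limit λ1R/B² is claimed except when Q=0 and A>0, where it fails: the solution is identically 0 but λ1R/B²=2AR/B²>0. If A=Q=0 the formula's 0/0 is read as 0. *)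

theory Defs
  imports "HOL-Analysis.Analysis"
begin

definition riccati_rhs :: "real \<Rightarrow> real \<Rightarrow> real \<Rightarrow> real \<Rightarrow> real \<Rightarrow> real" where
  "riccati_rhs A B Q R \<theta> = - (B\<^sup>2 / R) * \<theta>\<^sup>2 + 2 * A * \<theta> + Q"

text \<open>Only the values on \<open>[0, T]\<close> are constrained; continuity there ties the initial value
  at \<open>0\<close> to the equation on the open interval.\<close>

definition riccati_ivp_solution ::
    "real \<Rightarrow> real \<Rightarrow> real \<Rightarrow> real \<Rightarrow> real \<Rightarrow> (real \<Rightarrow> real) \<Rightarrow> bool" where
  "riccati_ivp_solution A B Q R T \<theta> \<longleftrightarrow>
     continuous_on {0..T} \<theta> \<and>
     (\<forall>\<tau>\<in>{0<..<T}. (\<theta> has_real_derivative riccati_rhs A B Q R (\<theta> \<tau>)) (at \<tau>)) \<and>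
     \<theta> 0 = 0"

definition algebraic_riccati :: "real \<Rightarrow> real \<Rightarrow> real \<Rightarrow> real \<Rightarrow> real \<Rightarrow> bool" where
  "algebraic_riccati A B Q R \<theta> \<longleftrightarrow> riccati_rhs A B Q R \<theta> = 0"

text \<open>The joint regime \<open>T \<rightarrow> \<infinity>\<close>, \<open>\<tau> \<rightarrow> \<infinity>\<close> with \<open>\<tau> < T\<close>, on pairs \<open>(T, \<tau>)\<close>.\<close>

definition long_horizon :: "(real \<times> real) filter" where
  "long_horizon = inf (at_top \<times>\<^sub>F at_top) (principal {(T, \<tau>). \<tau> < T})"

text \<open>The infinite-horizon problem. Controls are measurable and locally square integrable on
  \<open>[0, \<infinity>)\<close>; the state equation \<open>y' = A y + B \<alpha>\<close>, \<open>y(0) = x\<close> is understood in integrated form.\<close>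

definition lq_process ::
    "real \<Rightarrow> real \<Rightarrow> real \<Rightarrow> (real \<Rightarrow> real) \<Rightarrow> (real \<Rightarrow> real) \<Rightarrow> bool" where
  "lq_process A B x \<alpha> y \<longleftrightarrow>
     \<alpha> \<in> borel_measurable borel \<and>
     (\<forall>t\<ge>0. set_integrable lborel {0..t} (\<lambda>s. (\<alpha> s)\<^sup>2)) \<and>
     continuous_on {0..} y \<and>
     (\<forall>t\<ge>0. y t = x + (LINT s:{0..t}|lborel. A * y s + B * \<alpha> s))"

definition lq_cost :: "real \<Rightarrow> real \<Rightarrow> (real \<Rightarrow> real) \<Rightarrow> (real \<Rightarrow> real) \<Rightarrow> ennreal" where
  "lq_cost Q R \<alpha> y =
     (\<integral>\<^sup>+ s\<in>{0..}. ennreal (1 / 2 * Q * (y s)\<^sup>2 + 1 / 2 * R * (\<alpha> s)\<^sup>2) \<partial>lborel)"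

definition lq_value :: "real \<Rightarrow> real \<Rightarrow> real \<Rightarrow> real \<Rightarrow> real \<Rightarrow> ennreal" where
  "lq_value A B Q R x = (INF (\<alpha>, y)\<in>{(\<alpha>, y). lq_process A B x \<alpha> y}. lq_cost Q R \<alpha> y)"

definition lq_optimal ::
    "real \<Rightarrow> real \<Rightarrow> real \<Rightarrow> real \<Rightarrow> real \<Rightarrow> (real \<Rightarrow> real) \<Rightarrow> (real \<Rightarrow> real) \<Rightarrow> bool" where
  "lq_optimal A B Q R x \<alpha> y \<longleftrightarrow>
     lq_process A B x \<alpha> y \<and> lq_cost Q R \<alpha> y = lq_value A B Q R x"

text \<open>The sense in which a number \<open>\<theta>\<close> characterizes the infinite-horizon optimum: the value function
  is \<open>\<theta> x\<^sup>2 / 2\<close> and the feedback law \<open>\<alpha> = - (B / R) \<theta> y\<close> is optimal from every initial state.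
  Nonnegativity is required separately because \<open>ennreal\<close> maps negative numbers to \<open>0\<close>.\<close>

definition characterizes_infinite_horizon_optimum ::
    "real \<Rightarrow> real \<Rightarrow> real \<Rightarrow> real \<Rightarrow> real \<Rightarrow> bool" where
  "characterizes_infinite_horizon_optimum A B Q R \<theta> \<longleftrightarrow>
     0 \<le> \<theta> \<and>
     (\<forall>x. lq_value A B Q R x = ennreal (1 / 2 * \<theta> * x\<^sup>2) \<and>
          (\<exists>\<alpha> y. lq_optimal A B Q R x \<alpha> y \<and> (\<forall>t\<ge>0. \<alpha> t = - (B / R) * \<theta> * y t)))"

end

theory Submission
  imports Defs
begin

text \<open>Two solutions of the Riccati equation agree by a Gronwall argument. For the infinite-horizon
  problem, completing the square in the control shows that the cost up to time \<open>t\<close> plus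
  \<open>\<theta> (y t)\<^sup>2 / 2\<close> is at least \<open>\<theta> x\<^sup>2 / 2\<close>; if \<open>Q > 0\<close> and the cost is finite then \<open>y\<close> comes arbitrarily
  close to \<open>0\<close>, so every control costs at least \<open>\<theta> x\<^sup>2 / 2\<close>, and the feedback law attains this value.
  If \<open>Q = 0\<close> the zero control is optimal, and for \<open>A > 0\<close> the limit is then the root \<open>0\<close> of the algebraic
  equation rather than \<open>lam1 * R / B\<^sup>2\<close>.\<close>

section \<open>Energy identity for states given as indefinite integrals\<close>

text \<open>The chain rule for the square of an absolutely continuous function, obtained without
  differentiating \<open>y\<close>, since \<open>g\<close> is merely integrable. On a short interval
  the defect is at most \<open>e\<close> times the integral of \<open>\<bar>g\<bar>\<close>; these
  bounds add up over adjacent intervals, so bisection carries them to \<open>{0..T}\<close>, and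
  \<open>e\<close> is arbitrary.\<close>

lemma square_of_indefinite_integral:
  fixes g y :: "real \<Rightarrow> real"
  assumes T: "0 \<le> T" and g: "g absolutely_integrable_on {0..T}"
    and y: "\<And>t. t \<in> {0..T} \<Longrightarrow> y t = x + integral {0..t} g"
  shows "(\<lambda>s. y s * g s) absolutely_integrable_on {0..T}"
    and "(y T)\<^sup>2 = x\<^sup>2 + 2 * integral {0..T} (\<lambda>s. y s * g s)"
proof -
  have gi: "g integrable_on {0..T}"
    using g by (rule set_lebesgue_integral_eq_integral(1))
  have cont: "continuous_on {0..T} y"
    using continuous_on_add[OF continuous_on_const indefinite_integral_continuous_1[OF gi]]
    by (subst continuous_on_cong[OF refl y])
  show prod: "(\<lambda>s. y s * g s) absolutely_integrable_on {0..T}"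
  proof (rule absolutely_integrable_bounded_measurable_product_real)
    show "y \<in> borel_measurable (lebesgue_on {0..T})"
      using cont by (rule continuous_imp_measurable_on_sets_lebesgue) simp
    show "bounded (y ` {0..T})"
      by (intro compact_imp_bounded compact_continuous_image cont) simp
  qed (use g in simp_all)
  have yg: "(\<lambda>s. y s * g s) integrable_on {0..T}"
    using prod by (rule set_lebesgue_integral_eq_integral(1))
  have absg: "(\<lambda>s. \<bar>g s\<bar>) integrable_on {0..T}"
    using g by (simp add: absolutely_integrable_on_def)
  note sub = integrable_on_subinterval
  define F where "F t = (y t)\<^sup>2 - 2 * integral {0..t} (\<lambda>s. y s * g s)" for t
  have small: "\<bar>F T - F 0\<bar> \<le> e * integral {0..T} (\<lambda>s. \<bar>g s\<bar>)" if e: "0 < e" for e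
  proof -
    \<comment> \<open>The guard sits inside \<open>P\<close> because \<open>Bolzano\<close>
      quantifies over all short intervals around \<open>z\<close>, including those that leave
      \<open>{0..T}\<close>.\<close>
    define P where "P a b \<longleftrightarrow> (0 \<le> a \<and> b \<le> T \<longrightarrow>
      \<bar>F b - F a\<bar> \<le> e * integral {a..b} (\<lambda>s. \<bar>g s\<bar>))" for a b
    have "P 0 T"
    proof (rule Bolzano[OF T])
      fix a b c :: real
      assume P: "P a b" "P b c" and le: "a \<le> b" "b \<le> c"
      show "P a c"
        unfolding P_def
      proof
        assume ac: "0 \<le> a \<and> c \<le> T"
        have i: "(\<lambda>s. \<bar>g s\<bar>) integrable_on {a..c}"
          using absg by (rule sub) (use ac in auto)
        have "integral {a..c} (\<lambda>s. \<bar>g s\<bar>)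
            = integral {a..b} (\<lambda>s. \<bar>g s\<bar>) + integral {b..c} (\<lambda>s. \<bar>g s\<bar>)"
          using Henstock_Kurzweil_Integration.integral_combine[OF le i] by simp
        moreover have "\<bar>F b - F a\<bar> \<le> e * integral {a..b} (\<lambda>s. \<bar>g s\<bar>)"
          "\<bar>F c - F b\<bar> \<le> e * integral {b..c} (\<lambda>s. \<bar>g s\<bar>)"
          using P ac le by (auto simp: P_def)
        ultimately show "\<bar>F c - F a\<bar> \<le> e * integral {a..c} (\<lambda>s. \<bar>g s\<bar>)"
          by (simp add: distrib_left)
      qed
    next
      fix z assume z: "0 \<le> z" "z \<le> T"
      obtain d where d: "0 < d" "\<And>s. s \<in> {0..T} \<Longrightarrow> \<bar>s - z\<bar> < d \<Longrightarrow> \<bar>y s - y z\<bar> < e / 4"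
        using cont z e unfolding continuous_on_iff dist_real_def
        by (metis atLeastAtMost_iff zero_less_divide_iff zero_less_numeral)
      have "P a b" if ab: "a \<le> z" "z \<le> b" "b - a < d" for a b
        unfolding P_def
      proof
        assume ab': "0 \<le> a \<and> b \<le> T"
        have gab: "g integrable_on {a..b}" "(\<lambda>s. y s * g s) integrable_on {a..b}"
          "(\<lambda>s. \<bar>g s\<bar>) integrable_on {a..b}"
          by (rule sub[OF gi] sub[OF yg] sub[OF absg], use ab' in auto)+
        have split: "integral {0..b} f = integral {0..a} f + integral {a..b} f"
          if "f integrable_on {0..T}" for f :: "real \<Rightarrow> real"
        proof -
          have "f integrable_on {0..b}" using that by (rule sub) (use ab' in auto)
          from Henstock_Kurzweil_Integration.integral_combine[OF _ _ this, of a]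
          show ?thesis using ab ab' by simp
        qed
        have "y b - y a = integral {a..b} g"
          using y[of a] y[of b] split[OF gi] ab ab' by simp
        \<comment> \<open>Factoring the difference of squares turns the increment of
          \<open>F\<close> into one integral of \<open>g\<close> with weight
          \<open>y b + y a - 2 * y s\<close>. This weight collects four deviations from
          \<open>y z\<close>, each below \<open>e / 4\<close>.\<close>
        then have "F b - F a = (y b + y a) * integral {a..b} g - 2 * integral {a..b} (\<lambda>s. y s * g s)"
          unfolding F_def split[OF yg] by (simp add: power2_eq_square algebra_simps flip: \<open>y b - y a = _\<close>)
        also have "\<dots> = integral {a..b} (\<lambda>s. (y b + y a) * g s - 2 * (y s * g s))"
          using gab by (simp add: Henstock_Kurzweil_Integration.integral_diff integrable_on_mult_right)
        also have "\<bar>\<dots>\<bar> \<le> integral {a..b} (\<lambda>s. e * \<bar>g s\<bar>)"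
        proof (rule integral_norm_bound_integral[where 'a = real, unfolded real_norm_def])
          fix s assume s: "s \<in> {a..b}"
          have "\<bar>y s - y z\<bar> < e / 4" "\<bar>y a - y z\<bar> < e / 4" "\<bar>y b - y z\<bar> < e / 4"
            by (rule d(2); use s ab ab' in auto)+
          then have "\<bar>y b + y a - 2 * y s\<bar> \<le> e" by linarith
          then have "\<bar>y b + y a - 2 * y s\<bar> * \<bar>g s\<bar> \<le> e * \<bar>g s\<bar>"
            by (rule mult_right_mono) simp
          then show "\<bar>(y b + y a) * g s - 2 * (y s * g s)\<bar> \<le> e * \<bar>g s\<bar>"
            by (simp add: abs_mult[symmetric] algebra_simps)
        qed (use gab in \<open>auto intro!: Henstock_Kurzweil_Integration.integrable_diff integrable_on_mult_right\<close>)
        finally show "\<bar>F b - F a\<bar> \<le> e * integral {a..b} (\<lambda>s. \<bar>g s\<bar>)" by simp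
      qed
      with d(1) show "\<exists>d>0. \<forall>a b. a \<le> z \<and> z \<le> b \<and> b - a < d \<longrightarrow> P a b" by blast
    qed
    then show ?thesis by (simp add: P_def)
  qed
  have "\<bar>F T - F 0\<bar> \<le> 0"
  proof (rule field_le_epsilon)
    fix e :: real assume e: "0 < e"
    define C where "C = integral {0..T} (\<lambda>s. \<bar>g s\<bar>)"
    have C: "0 \<le> C" unfolding C_def by (intro integral_nonneg absg) simp
    \<comment> \<open>Dividing by \<open>C + 1\<close> covers the case \<open>C = 0\<close>.\<close>
    have "\<bar>F T - F 0\<bar> \<le> e / (C + 1) * C"
      unfolding C_def by (rule small) (use C e in \<open>simp flip: C_def\<close>)
    also have "\<dots> \<le> e" using C e by (simp add: field_simps)
    finally show "\<bar>F T - F 0\<bar> \<le> 0 + e" by simp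
  qed
  then show "(y T)\<^sup>2 = x\<^sup>2 + 2 * integral {0..T} (\<lambda>s. y s * g s)"
    using y[of 0] T by (simp add: F_def)
qed

section \<open>Integrability along processes and the lower bound on the cost\<close>

text \<open>Moves the Borel-Lebesgue integrals of \<open>lq_process\<close> to gauge integrals on
  compact intervals. Square integrability of the control yields integrability because intervals have
  finite measure.\<close>

lemma lq_process_absolutely_integrable:
  assumes "lq_process A B x \<alpha> y" and t: "0 \<le> t"
  shows "\<alpha> absolutely_integrable_on {0..t}" "(\<lambda>s. (\<alpha> s)\<^sup>2) absolutely_integrable_on {0..t}"
    "y absolutely_integrable_on {0..t}" "(\<lambda>s. (y s)\<^sup>2) absolutely_integrable_on {0..t}"
    "y t = x + integral {0..t} (\<lambda>s. A * y s + B * \<alpha> s)"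
proof -
  have [measurable]: "\<alpha> \<in> borel_measurable borel" and sq: "set_integrable lborel {0..t} (\<lambda>s. (\<alpha> s)\<^sup>2)"
    and cont: "continuous_on {0..t} y"
    and yt: "y t = x + (LINT s:{0..t}|lborel. A * y s + B * \<alpha> s)"
    using assms by (auto simp: lq_process_def intro: continuous_on_subset)
  have y_int: "set_integrable lborel {0..t} y" "set_integrable lborel {0..t} (\<lambda>s. (y s)\<^sup>2)"
    by (intro borel_integrable_atLeastAtMost' cont continuous_intros)+
  have "set_integrable lborel {0..t} (\<lambda>s. 1 + (\<alpha> s)\<^sup>2)"
    by (intro set_integral_add(1) sq borel_integrable_atLeastAtMost' continuous_intros)
  then have \<alpha>_int: "set_integrable lborel {0..t} \<alpha>"
  proof (rule set_integrable_bound)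
    show "AE s in lborel. s \<in> {0..t} \<longrightarrow> norm (\<alpha> s) \<le> norm (1 + (\<alpha> s)\<^sup>2)"
    proof (intro AE_I2 impI)
      fix s
      \<comment> \<open>Expanding the square gives \<bar>a\<bar> \<le> a^2 + 1/4.\<close>
      have "0 \<le> (\<bar>\<alpha> s\<bar> - 1 / 2)\<^sup>2" by simp
      then show "norm (\<alpha> s) \<le> norm (1 + (\<alpha> s)\<^sup>2)"
        by (simp add: power2_diff power_one_over)
    qed
  qed (simp add: set_borel_measurable_def)
  have conv: "f absolutely_integrable_on {0..t}" if "set_integrable lborel {0..t} f" for f :: "real \<Rightarrow> real"
    using that unfolding set_integrable_def
    by (subst integrable_completion) (auto dest: borel_measurable_integrable)
  show "\<alpha> absolutely_integrable_on {0..t}" "(\<lambda>s. (\<alpha> s)\<^sup>2) absolutely_integrable_on {0..t}"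
    "y absolutely_integrable_on {0..t}" "(\<lambda>s. (y s)\<^sup>2) absolutely_integrable_on {0..t}"
    by (rule conv, fact)+
  have "set_integrable lborel {0..t} (\<lambda>s. A * y s + B * \<alpha> s)"
    by (intro set_integral_add(1) set_integrable_mult_right y_int \<alpha>_int)
  then show "y t = x + integral {0..t} (\<lambda>s. A * y s + B * \<alpha> s)"
    using yt by (simp add: set_borel_integral_eq_integral(2))
qed

text \<open>The running cost is nonnegative, so truncating the time axis can only lower the cost.
  Completing the measure leaves the nonnegative integral unchanged.\<close>

lemma lq_cost_ge_integral:
  assumes "lq_process A B x \<alpha> y" "0 \<le> t" "0 \<le> Q" "0 \<le> R"
  shows "ennreal (integral {0..t} (\<lambda>s. 1 / 2 * Q * (y s)\<^sup>2 + 1 / 2 * R * (\<alpha> s)\<^sup>2)) \<le> lq_cost Q R \<alpha> y"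
proof -
  define l where "l s = 1 / 2 * Q * (y s)\<^sup>2 + 1 / 2 * R * (\<alpha> s)\<^sup>2" for s
  have "(\<lambda>s. 1 / 2 * Q * (y s)\<^sup>2 + 1 / 2 * R * (\<alpha> s)\<^sup>2) absolutely_integrable_on {0..t}"
    by (intro set_integral_add(1) set_integrable_mult_right lq_process_absolutely_integrable[OF assms(1,2)])
  then have l: "l absolutely_integrable_on {0..t}" by (simp add: l_def[abs_def])
  have nn: "0 \<le> l s" for s using assms by (simp add: l_def)
  have "integral {0..t} l = integral\<^sup>L lebesgue (\<lambda>s. indicator {0..t} s *\<^sub>R l s)"
    using set_lebesgue_integral_eq_integral(2)[OF l] by (simp add: set_lebesgue_integral_def)
  also have "ennreal \<dots> = (\<integral>\<^sup>+ s. ennreal (indicator {0..t} s *\<^sub>R l s) \<partial>lebesgue)"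
    by (rule nn_integral_eq_integral[symmetric]) (use l nn in \<open>auto simp: set_integrable_def\<close>)
  also have "\<dots> = (\<integral>\<^sup>+ s. ennreal (indicator {0..t} s *\<^sub>R l s) \<partial>lborel)"
    by (rule nn_integral_completion)
  also have "\<dots> \<le> (\<integral>\<^sup>+ s\<in>{0..}. ennreal (l s) \<partial>lborel)"
    by (intro nn_integral_mono) (auto split: split_indicator)
  finally show ?thesis unfolding lq_cost_def l_def[abs_def] .
qed

lemma lq_cost_lower_bound:
  assumes p: "lq_process A B x \<alpha> y" and Q: "0 < Q" and R: "0 < R" and \<theta>: "0 \<le> \<theta>"
    and ric: "algebraic_riccati A B Q R \<theta>"
  shows "ennreal (1 / 2 * \<theta> * x\<^sup>2) \<le> lq_cost Q R \<alpha> y"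
proof (cases "lq_cost Q R \<alpha> y")
  case (real c)
  define l where "l s = 1 / 2 * Q * (y s)\<^sup>2 + 1 / 2 * R * (\<alpha> s)\<^sup>2" for s
  define g where "g s = A * y s + B * \<alpha> s" for s
  note int = lq_process_absolutely_integrable[OF p]
  have li: "l integrable_on {0..t}" if "0 \<le> t" for t
    unfolding l_def[abs_def]
    by (rule set_lebesgue_integral_eq_integral(1),
        intro set_integral_add(1) set_integrable_mult_right int that)
  have cost: "integral {0..t} l \<le> c" if "0 \<le> t" for t
  proof -
    have "ennreal (integral {0..t} l) \<le> ennreal c"
      using lq_cost_ge_integral[OF p that, of Q R] Q R real by (simp add: l_def[abs_def])
    then show ?thesis using real by (simp add: ennreal_le_iff)
  qed
  have energy: "1 / 2 * \<theta> * x\<^sup>2 \<le> c + 1 / 2 * \<theta> * (y t)\<^sup>2" if t: "0 \<le> t" for t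
  proof -
    have "g absolutely_integrable_on {0..t}"
      unfolding g_def[abs_def] by (intro set_integral_add(1) set_integrable_mult_right int t)
    moreover have "y r = x + integral {0..r} g" if "r \<in> {0..t}" for r
      using int(5)[of r] that by (simp add: g_def[abs_def])
    ultimately have yg: "(\<lambda>s. y s * g s) absolutely_integrable_on {0..t}"
      and y2: "(y t)\<^sup>2 = x\<^sup>2 + 2 * integral {0..t} (\<lambda>s. y s * g s)"
      using square_of_indefinite_integral[OF t, of g y x] by blast+
    have ygi: "(\<lambda>s. y s * g s) integrable_on {0..t}"
      using yg by (rule set_lebesgue_integral_eq_integral(1))
    \<comment> \<open>completion of the square in the control\<close>
    have square: "l s + \<theta> * (y s * g s) = 1 / 2 * R * (\<alpha> s + B * \<theta> * y s / R)\<^sup>2" for s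
    proof -
      \<comment> \<open>The algebraic Riccati equation is solved for \<open>Q\<close>; naming the
        quadratic term keeps divisions out of the ring computation.\<close>
      define q where "q = B\<^sup>2 / R * \<theta>\<^sup>2"
      have Q_eq: "Q = q - 2 * A * \<theta>"
        using ric by (simp add: algebraic_riccati_def riccati_rhs_def q_def)
      have "1 / 2 * R * (\<alpha> s + B * \<theta> * y s / R)\<^sup>2
          = 1 / 2 * R * (\<alpha> s)\<^sup>2 + B * \<theta> * y s * \<alpha> s + 1 / 2 * q * (y s)\<^sup>2"
        using R by (simp add: q_def power2_eq_square field_simps)
      then show ?thesis
        unfolding l_def g_def Q_eq by (simp add: power2_eq_square algebra_simps)
    qed
    have "0 \<le> integral {0..t} (\<lambda>s. l s + \<theta> * (y s * g s))"
      using R by (intro integral_nonneg integrable_add li t integrable_on_mult_right ygi) (simp add: square)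
    also have "\<dots> = integral {0..t} l + \<theta> * integral {0..t} (\<lambda>s. y s * g s)"
      using li[OF t] ygi by (simp add: Henstock_Kurzweil_Integration.integral_add integrable_on_mult_right)
    also have "\<dots> \<le> c + \<theta> * (((y t)\<^sup>2 - x\<^sup>2) / 2)"
      using cost[OF t] y2 by simp
    finally show ?thesis by (simp add: field_simps)
  qed
  have "1 / 2 * \<theta> * x\<^sup>2 \<le> c"
  proof (rule ccontr)
    assume "\<not> ?thesis"
    then have e: "0 < 1 / 2 * \<theta> * x\<^sup>2 - c" by simp
    \<comment> \<open>otherwise the state stays away from zero and its running cost is not integrable\<close>
    have \<theta>pos: "0 < \<theta>"
      using e \<theta> real by (cases "\<theta> = 0") auto
    \<comment> \<open>The inequality \<open>energy\<close>, multiplied by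
      \<open>Q / \<theta>\<close>, reads \<open>d \<le> 1 / 2 * Q * (y s)\<^sup>2\<close>.\<close>
    define d where "d = Q * (1 / 2 * \<theta> * x\<^sup>2 - c) / \<theta>"
    have d: "0 < d" using e \<theta>pos Q by (simp add: d_def)
    have "d \<le> l s" if "0 \<le> s" for s
    proof -
      have "d \<le> 1 / 2 * Q * (y s)\<^sup>2"
        using energy[OF that] \<theta>pos Q mult_left_mono[OF energy[OF that], of Q]
        by (simp add: d_def field_simps)
      also have "\<dots> \<le> l s" using R by (simp add: l_def)
      finally show ?thesis .
    qed
    \<comment> \<open>Long enough for the constant \<open>d\<close> to integrate to
      \<open>c + 1\<close>, above the bound \<open>c\<close>.\<close>
    moreover define t where "t = (c + 1) / d"
    moreover have t: "0 \<le> t" using d real by (simp add: t_def)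
    ultimately have "integral {0..t} (\<lambda>s. d) \<le> integral {0..t} l"
      by (intro integral_le li) auto
    also have "\<dots> \<le> c" using t by (rule cost)
    finally show False using t d by (simp add: t_def)
  qed
  then show ?thesis using real by (simp add: ennreal_leI)
qed simp

section \<open>Linear feedback and the infinite-horizon optimum\<close>

text \<open>The control \<open>k\<close> times the state closes the loop to a linear equation with
  rate \<open>A + B * k\<close>. The gain \<open>k = 0\<close> gives the uncontrolled
  trajectory.\<close>

lemma lq_process_feedback:
  "lq_process A B x (\<lambda>t. k * (x * exp ((A + B * k) * t))) (\<lambda>t. x * exp ((A + B * k) * t))"
proof -
  have "x * exp ((A + B * k) * t) = x + (LINT s:{0..t}|lborel. A * (x * exp ((A + B * k) * s)) +
    B * (k * (x * exp ((A + B * k) * s))))" if "0 \<le> t" for t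
    unfolding set_lebesgue_integral_def
    by (subst integral_FTC_atLeastAtMost[OF that, where F = "\<lambda>s. x * exp ((A + B * k) * s)"])
      (auto intro!: derivative_eq_intros continuous_intros
        simp: algebra_simps simp flip: has_real_derivative_iff_has_vector_derivative)
  then show ?thesis
    unfolding lq_process_def
    by (auto intro!: borel_integrable_atLeastAtMost' continuous_intros)
qed

text \<open>Along the closed loop the running cost is a multiple of exp(2 r s) with r = A + B k. As
  r < 0, the antiderivative vanishes at infinity and only its value at 0 remains.\<close>

lemma lq_cost_feedback:
  assumes r: "A + B * k < 0" and "0 \<le> Q" "0 \<le> R"
  shows "lq_cost Q R (\<lambda>t. k * (x * exp ((A + B * k) * t))) (\<lambda>t. x * exp ((A + B * k) * t))
    = ennreal (- ((Q + R * k\<^sup>2) * x\<^sup>2 / (4 * (A + B * k))))"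
proof -
  define r where "r = A + B * k"
  have "lq_cost Q R (\<lambda>t. k * (x * exp (r * t))) (\<lambda>t. x * exp (r * t))
    = (\<integral>\<^sup>+ s. ennreal ((Q + R * k\<^sup>2) / 2 * x\<^sup>2 * exp (2 * r * s)) * indicator {0..} s \<partial>lborel)"
    unfolding lq_cost_def
    by (intro nn_integral_cong arg_cong2[where f = "(*)"] arg_cong[where f = ennreal])
      (simp_all add: power_mult_distrib power2_eq_square algebra_simps flip: exp_add)
  also have "\<dots> = ennreal (0 - (Q + R * k\<^sup>2) * x\<^sup>2 / (4 * r) * exp (2 * r * 0))"
  proof (rule nn_integral_FTC_atLeast)
    have "LIM s at_top. 2 * r * s :> at_bot"
      using r by (intro filterlim_tendsto_neg_mult_at_bot[OF tendsto_const] filterlim_ident) (simp add: r_def)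
    then have "((\<lambda>s. exp (2 * r * s)) \<longlongrightarrow> 0) at_top"
      by (rule filterlim_compose[OF exp_at_bot])
    then show "((\<lambda>s. (Q + R * k\<^sup>2) * x\<^sup>2 / (4 * r) * exp (2 * r * s)) \<longlongrightarrow> 0) at_top"
      by (rule tendsto_mult_right_zero)
  qed (use assms in \<open>auto intro!: derivative_eq_intros simp: r_def[symmetric] field_simps\<close>)
  finally show ?thesis by (simp add: r_def)
qed

text \<open>Without a state cost the zero control is free, even if the trajectory grows, and no cost
  lies below 0.\<close>

lemma characterizes_infinite_horizon_optimum_zero:
  "characterizes_infinite_horizon_optimum A B 0 R 0"
proof -
  have z: "lq_process A B x (\<lambda>t. 0) (\<lambda>t. x * exp (A * t))" for x
    using lq_process_feedback[of A B x 0] by simp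
  have c: "lq_cost 0 R (\<lambda>t. 0) y = 0" for y
    by (simp add: lq_cost_def)
  have v: "lq_value A B 0 R x = 0" for x
  proof -
    have "lq_value A B 0 R x \<le> lq_cost 0 R (\<lambda>t. 0) (\<lambda>t. x * exp (A * t))"
      unfolding lq_value_def by (rule INF_lower2[of "(\<lambda>t. 0, \<lambda>t. x * exp (A * t))"]) (use z in auto)
    then show ?thesis by (simp add: c)
  qed
  have "lq_optimal A B 0 R x (\<lambda>t. 0) (\<lambda>t. x * exp (A * t))" for x
    using z c v by (simp add: lq_optimal_def)
  then have "\<exists>\<alpha> y. lq_optimal A B 0 R x \<alpha> y \<and> (\<forall>t\<ge>0. \<alpha> t = - (B / R) * 0 * y t)" for x
    by (intro exI[of _ "\<lambda>t. 0"] exI[of _ "\<lambda>t. x * exp (A * t)"]) simp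
  with v show ?thesis
    by (simp add: characterizes_infinite_horizon_optimum_def)
qed

text \<open>The hypothesis \<open>stable\<close> says that the closed-loop rate
  \<open>A + B * k\<close> is negative, so that the feedback cost can be evaluated; it then meets
  the lower bound.\<close>

lemma characterizes_infinite_horizon_optimum_pos:
  assumes Q: "0 < Q" and R: "0 < R" and \<theta>: "0 \<le> \<theta>" and ric: "algebraic_riccati A B Q R \<theta>"
    and stable: "A < B\<^sup>2 / R * \<theta>"
  shows "characterizes_infinite_horizon_optimum A B Q R \<theta>"
proof -
  define k where "k = - (B / R) * \<theta>"
  define \<alpha> where "\<alpha> x t = k * (x * exp ((A + B * k) * t))" for x t
  define y where "y x t = x * exp ((A + B * k) * t)" for x t
  have p: "lq_process A B x (\<alpha> x) (y x)" for x
    unfolding \<alpha>_def[abs_def] y_def[abs_def] by (rule lq_process_feedback)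
  have Bk: "A + B * k = A - B\<^sup>2 / R * \<theta>"
    by (simp add: k_def power2_eq_square)
  define m where "m = B\<^sup>2 / R"
  have "Q = B\<^sup>2 / R * \<theta>\<^sup>2 - 2 * A * \<theta>"
    using ric by (simp add: algebraic_riccati_def riccati_rhs_def)
  moreover have "R * k\<^sup>2 = B\<^sup>2 / R * \<theta>\<^sup>2"
    using R by (simp add: k_def power2_eq_square)
  \<comment> \<open>The Riccati equation makes the rate a factor of the cost coefficient; it cancels
    in the formula of \<open>lq_cost_feedback\<close>, leaving
    \<open>\<theta> * x\<^sup>2 / 2\<close>.\<close>
  ultimately have num: "Q + R * k\<^sup>2 = - (2 * \<theta> * (A + B * k))"
    unfolding Bk m_def[symmetric] by (simp add: power2_eq_square algebra_simps)
  have r: "A + B * k < 0" using Bk stable by simp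
  have cost: "lq_cost Q R (\<alpha> x) (y x) = ennreal (1 / 2 * \<theta> * x\<^sup>2)" for x
  proof -
    have "- (- (2 * \<theta> * r) * x\<^sup>2 / (4 * r)) = 1 / 2 * \<theta> * x\<^sup>2" if "r < 0" for r
      using that by (simp add: field_simps)
    then show ?thesis
      using lq_cost_feedback[OF r less_imp_le[OF Q] less_imp_le[OF R], of x]
      by (simp only: num r \<alpha>_def[abs_def] y_def[abs_def])
  qed
  have "lq_value A B Q R x = ennreal (1 / 2 * \<theta> * x\<^sup>2)" for x
  proof (rule antisym)
    show "lq_value A B Q R x \<le> ennreal (1 / 2 * \<theta> * x\<^sup>2)"
      unfolding lq_value_def by (rule INF_lower2[of "(\<alpha> x, y x)"]) (use p cost in auto)
    show "ennreal (1 / 2 * \<theta> * x\<^sup>2) \<le> lq_value A B Q R x"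
      unfolding lq_value_def using lq_cost_lower_bound[OF _ Q R \<theta> ric] by (auto intro!: INF_greatest)
  qed
  moreover have "\<alpha> x t = - (B / R) * \<theta> * y x t" for x t
    by (simp add: \<alpha>_def y_def k_def)
  ultimately show ?thesis
    unfolding characterizes_infinite_horizon_optimum_def lq_optimal_def using p \<theta> cost by metis
qed

section \<open>Uniqueness, closed form and limit for the Riccati problem\<close>

text \<open>The difference w of two solutions satisfies w' = c w, where c is bounded by some K
  because both solutions are continuous on a compact interval. Hence w^2 exp(-2 K s) is
  nonincreasing, and it starts at 0.\<close>

lemma riccati_ivp_solution_unique:
  assumes 1: "riccati_ivp_solution A B Q R T \<theta>" and 2: "riccati_ivp_solution A B Q R T \<eta>"
    and t: "t \<in> {0..T}"
  shows "\<theta> t = \<eta> t"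
proof -
  define c where "c s = 2 * A - B\<^sup>2 / R * (\<theta> s + \<eta> s)" for s
  have cont: "continuous_on {0..T} \<theta>" "continuous_on {0..T} \<eta>"
    using 1 2 by (auto simp: riccati_ivp_solution_def)
  have "bounded (c ` {0..T})"
    unfolding c_def[abs_def] by (intro compact_imp_bounded compact_continuous_image continuous_intros cont) simp
  then obtain K where "\<forall>v\<in>c ` {0..T}. norm v \<le> K"
    unfolding bounded_iff by blast
  then have K: "\<bar>c s\<bar> \<le> K" if "s \<in> {0..T}" for s
    using that by simp
  define W where "W s = (\<theta> s - \<eta> s)\<^sup>2 * exp (- (2 * K) * s)" for s
  have "W t \<le> W 0"
  proof (rule DERIV_nonpos_imp_decreasing_open[where f = W])
    fix s assume s: "0 < s" "s < t"
    then have sT: "s \<in> {0<..<T}" using t by auto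
    then have d: "(\<theta> has_real_derivative riccati_rhs A B Q R (\<theta> s)) (at s)"
      "(\<eta> has_real_derivative riccati_rhs A B Q R (\<eta> s)) (at s)"
      using 1 2 by (auto simp: riccati_ivp_solution_def)
    have diff: "riccati_rhs A B Q R (\<theta> s) - riccati_rhs A B Q R (\<eta> s) = c s * (\<theta> s - \<eta> s)"
      by (simp add: riccati_rhs_def c_def power2_eq_square algebra_simps diff_divide_distrib)
    have "(W has_real_derivative 2 * (\<theta> s - \<eta> s) * (riccati_rhs A B Q R (\<theta> s) - riccati_rhs A B Q R (\<eta> s))
        * exp (- (2 * K) * s) + (\<theta> s - \<eta> s)\<^sup>2 * (exp (- (2 * K) * s) * - (2 * K))) (at s)"
      unfolding W_def[abs_def] by (rule derivative_eq_intros refl d | simp)+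
    moreover have "2 * (\<theta> s - \<eta> s) * (riccati_rhs A B Q R (\<theta> s) - riccati_rhs A B Q R (\<eta> s))
        * exp (- (2 * K) * s) + (\<theta> s - \<eta> s)\<^sup>2 * (exp (- (2 * K) * s) * - (2 * K))
      = - (2 * (K - c s) * W s)"
      unfolding diff W_def by (simp add: power2_eq_square algebra_simps)
    moreover have "0 \<le> 2 * (K - c s) * W s"
      using K[of s] sT by (auto simp: W_def)
    ultimately show "\<exists>y. (W has_real_derivative y) (at s) \<and> y \<le> 0"
      by (metis neg_le_0_iff_le)
  next
    show "continuous_on {0..t} W"
      unfolding W_def[abs_def] using t
      by (intro continuous_intros continuous_on_subset[OF cont(1)] continuous_on_subset[OF cont(2)]) auto
  qed (use t in auto)
  also have "W 0 = 0" using 1 2 by (simp add: W_def riccati_ivp_solution_def)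
  finally have "(\<theta> t - \<eta> t)\<^sup>2 \<le> 0" by (simp add: W_def mult_le_0_iff not_le[symmetric])
  then show ?thesis by simp
qed

text \<open>The case \<open>l1 = l2 = 0\<close> is included because \<open>0 / 0 = 0\<close>.\<close>

lemma riccati_ivp_solution_explicit:
  fixes l1 l2 :: real
  assumes Q: "Q = - (R / B\<^sup>2 * (l1 * l2))" and A: "2 * A = l1 + l2" and RB: "R \<noteq> 0" "B \<noteq> 0"
    and D: "l1 = 0 \<and> l2 = 0 \<or> (\<forall>t. l2 * exp (l1 * t) - l1 * exp (l2 * t) \<noteq> 0)"
  shows "riccati_ivp_solution A B Q R T (\<lambda>t. R / B\<^sup>2 * (l1 * l2) *
    ((exp (l1 * t) - exp (l2 * t)) / (l2 * exp (l1 * t) - l1 * exp (l2 * t))))"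
  using D
proof
  assume "l1 = 0 \<and> l2 = 0"
  then show ?thesis using Q by (simp add: riccati_ivp_solution_def riccati_rhs_def)
next
  assume D: "\<forall>t. l2 * exp (l1 * t) - l1 * exp (l2 * t) \<noteq> 0"
  define h where "h t = R / B\<^sup>2 * (l1 * l2) *
    ((exp (l1 * t) - exp (l2 * t)) / (l2 * exp (l1 * t) - l1 * exp (l2 * t)))" for t
  \<comment> \<open>Since E' = l1 l2 N, the candidate is R/B^2 times the logarithmic derivative of
    \<open>E\<close>: the classical linearization of a Riccati equation. The derivatives of
    \<open>N\<close> and \<open>E\<close> are linear in \<open>N\<close> and \<open>E\<close>, so no
    exponentials survive in the check.\<close>
  define N E where "N t = exp (l1 * t) - exp (l2 * t)"
    and "E t = l2 * exp (l1 * t) - l1 * exp (l2 * t)" for t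
  have h: "h = (\<lambda>t. R / B\<^sup>2 * (l1 * l2) * (N t / E t))"
    by (simp add: h_def N_def E_def fun_eq_iff)
  have "(h has_real_derivative riccati_rhs A B Q R (h t)) (at t)" for t
  proof -
    have E: "E t \<noteq> 0" using D by (simp add: E_def)
    have dN: "(N has_real_derivative (l1 + l2) * N t - E t) (at t)"
      unfolding N_def[abs_def] E_def by (auto intro!: derivative_eq_intros simp: algebra_simps)
    have dE: "(E has_real_derivative l1 * l2 * N t) (at t)"
      unfolding N_def E_def[abs_def] by (auto intro!: derivative_eq_intros simp: algebra_simps)
    have "(h has_real_derivative R / B\<^sup>2 * (l1 * l2) *
        ((((l1 + l2) * N t - E t) * E t - N t * (l1 * l2 * N t)) / (E t * E t))) (at t)"
      unfolding h by (intro DERIV_cmult DERIV_divide dN dE E)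
    also have "R / B\<^sup>2 * (l1 * l2) *
        ((((l1 + l2) * N t - E t) * E t - N t * (l1 * l2 * N t)) / (E t * E t)) = riccati_rhs A B Q R (h t)"
      unfolding riccati_rhs_def Q A h using E RB by (simp add: power2_eq_square field_simps)
    finally show ?thesis .
  qed
  moreover from this have "continuous_on {0..T} h"
    by (intro continuous_at_imp_continuous_on ballI) (rule DERIV_isCont)
  moreover have "h 0 = 0" by (simp add: h_def)
  ultimately have "riccati_ivp_solution A B Q R T h"
    by (simp add: riccati_ivp_solution_def)
  then show ?thesis unfolding h_def[abs_def] .
qed

text \<open>Cancelling exp(l1 t) from the quotient leaves only exp((l2 - l1) t), which tends to 0;
  the denominator then tends to \<open>l2\<close>, which is nonzero.\<close>

lemma riccati_explicit_tendsto:
  fixes l1 l2 :: real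
  assumes "l2 < l1" "l2 \<noteq> 0"
  shows "((\<lambda>t. c * (l1 * l2) * ((exp (l1 * t) - exp (l2 * t)) / (l2 * exp (l1 * t) - l1 * exp (l2 * t))))
    \<longlongrightarrow> l1 * c) at_top"
proof -
  have "LIM t at_top. (l2 - l1) * t :> at_bot"
    using assms by (intro filterlim_tendsto_neg_mult_at_bot[OF tendsto_const] filterlim_ident) simp
  then have e: "((\<lambda>t. exp ((l2 - l1) * t)) \<longlongrightarrow> 0) at_top"
    by (rule filterlim_compose[OF exp_at_bot])
  have "((\<lambda>t. c * (l1 * l2) * ((1 - exp ((l2 - l1) * t)) / (l2 - l1 * exp ((l2 - l1) * t))))
    \<longlongrightarrow> c * (l1 * l2) * ((1 - 0) / (l2 - l1 * 0))) at_top"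
    using assms by (intro tendsto_intros e) simp
  moreover have "(1 - exp ((l2 - l1) * t)) / (l2 - l1 * exp ((l2 - l1) * t))
    = (exp (l1 * t) - exp (l2 * t)) / (l2 * exp (l1 * t) - l1 * exp (l2 * t))" for t
  proof -
    have "exp (l2 * t) = exp (l1 * t) * exp ((l2 - l1) * t)"
      by (simp add: algebra_simps flip: exp_add)
    then have "exp (l1 * t) - exp (l2 * t) = exp (l1 * t) * (1 - exp ((l2 - l1) * t))"
      "l2 * exp (l1 * t) - l1 * exp (l2 * t) = exp (l1 * t) * (l2 - l1 * exp ((l2 - l1) * t))"
      by (simp_all add: algebra_simps)
    then show ?thesis by simp
  qed
  moreover have "c * (l1 * l2) * ((1 - 0) / (l2 - l1 * 0)) = l1 * c"
    using assms by simp
  ultimately show ?thesis by (simp only:)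
qed

text \<open>The constraint \<tau> < T keeps the pair where the solution for horizon T agrees with
  \<open>f\<close>, so the joint limit reduces to one in \<tau> alone.\<close>

lemma tendsto_long_horizon:
  assumes f: "(f \<longlongrightarrow> l) at_top" and eq: "\<And>S t. 0 \<le> t \<Longrightarrow> t < S \<Longrightarrow> \<Theta> S t = f t"
  shows "((\<lambda>(S, t). \<Theta> S t) \<longlongrightarrow> l) long_horizon"
proof -
  have "filterlim snd at_top long_horizon"
    unfolding long_horizon_def by (rule filterlim_mono[OF filterlim_snd order_refl inf_le1])
  then have lim: "((\<lambda>p. f (snd p)) \<longlongrightarrow> l) long_horizon"
    and nonneg: "eventually (\<lambda>p. 0 \<le> snd p) long_horizon"
    using f by (auto intro: filterlim_compose simp: filterlim_at_top)
  have "eventually (\<lambda>(S, t). t < S) long_horizon"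
    unfolding long_horizon_def eventually_inf_principal by auto
  with nonneg have "eventually (\<lambda>p. f (snd p) = (case p of (S, t) \<Rightarrow> \<Theta> S t)) long_horizon"
    by eventually_elim (auto simp: eq)
  then show ?thesis using lim by (rule Lim_transform_eventually[rotated])
qed

text \<open>\<open>\<Theta>\<close> selects an arbitrary solution for each horizon. For A = Q = 0
  both exponents vanish, so the denominator is 0 and the formula returns the correct value 0 only
  through the convention 0 / 0 = 0; hence the guard on the nonvanishing claim.\<close>

theorem mainTheorem1:
  fixes A B Q R T lam1 lam2 :: real and \<theta>hat :: "real \<Rightarrow> real"
  assumes "0 \<le> Q" and "0 < R" and "B \<noteq> 0" and "0 < T"
    and "lam1 = A + sqrt (A\<^sup>2 + Q * B\<^sup>2 / R)"
    and "lam2 = A - sqrt (A\<^sup>2 + Q * B\<^sup>2 / R)"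
    and "\<theta>hat = (\<lambda>\<tau>. R / B\<^sup>2 * (lam1 * lam2) *
           ((exp (lam1 * \<tau>) - exp (lam2 * \<tau>)) / (lam2 * exp (lam1 * \<tau>) - lam1 * exp (lam2 * \<tau>))))"
  shows "riccati_ivp_solution A B Q R T \<theta>hat
    \<and> (\<forall>\<theta>. riccati_ivp_solution A B Q R T \<theta> \<longrightarrow> (\<forall>\<tau>\<in>{0..T}. \<theta> \<tau> = \<theta>hat \<tau>))
    \<and> (A \<noteq> 0 \<or> Q \<noteq> 0 \<longrightarrow>
         (\<forall>\<tau>\<in>{0..T}. lam2 * exp (lam1 * \<tau>) - lam1 * exp (lam2 * \<tau>) \<noteq> 0))
    \<and> algebraic_riccati A B Q R (lam1 * R / B\<^sup>2)
    \<and> (\<forall>\<Theta>. (\<forall>S>0. riccati_ivp_solution A B Q R S (\<Theta> S)) \<longrightarrow>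
         (\<not> (Q = 0 \<and> A > 0) \<longrightarrow>
            ((\<lambda>(S, \<tau>). \<Theta> S \<tau>) \<longlongrightarrow> lam1 * R / B\<^sup>2) long_horizon) \<and>
         (\<exists>\<theta>inf. ((\<lambda>(S, \<tau>). \<Theta> S \<tau>) \<longlongrightarrow> \<theta>inf) long_horizon \<and>
            algebraic_riccati A B Q R \<theta>inf \<and>
            characterizes_infinite_horizon_optimum A B Q R \<theta>inf))"
proof -
  define s where "s = sqrt (A\<^sup>2 + Q * B\<^sup>2 / R)"
  have QB: "0 \<le> Q * B\<^sup>2 / R" using assms(1,2) by simp
  have s2: "s\<^sup>2 = A\<^sup>2 + Q * B\<^sup>2 / R" using QB by (simp add: s_def)
  have lam: "lam1 = A + s" "lam2 = A - s" using assms by (simp_all add: s_def)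
  have sA: "\<bar>A\<bar> \<le> s" unfolding s_def using QB by (intro real_le_rsqrt) simp
  have prod: "lam1 * lam2 = - (Q * B\<^sup>2 / R)"
    using s2 by (simp add: lam power2_eq_square algebra_simps)
  have Q: "Q = - (R / B\<^sup>2 * (lam1 * lam2))" using prod assms(2,3) by simp
  have lam_sign: "lam2 \<le> 0" "0 \<le> lam1" using sA by (auto simp: lam)
  have s_pos: "0 < s" if "A \<noteq> 0 \<or> Q \<noteq> 0"
  proof (rule ccontr)
    assume "\<not> ?thesis"
    then have "s = 0" "A = 0" using sA by auto
    then show False using that s2 assms(2,3) by simp
  qed
  \<comment> \<open>Neither summand is positive, and one is negative because lam1 - lam2 = 2 s >
    0.\<close>
  have D: "lam2 * exp (lam1 * t) - lam1 * exp (lam2 * t) < 0" if "A \<noteq> 0 \<or> Q \<noteq> 0" for t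
  proof -
    have "lam2 < 0 \<or> 0 < lam1" using s_pos[OF that] by (auto simp: lam)
    moreover have "lam2 * exp (lam1 * t) \<le> 0" "0 \<le> lam1 * exp (lam2 * t)"
      using lam_sign by (auto simp: mult_le_0_iff)
    moreover have "lam2 < 0 \<Longrightarrow> lam2 * exp (lam1 * t) < 0" "0 < lam1 \<Longrightarrow> 0 < lam1 * exp (lam2 * t)"
      by (auto simp: mult_neg_pos)
    ultimately show ?thesis by linarith
  qed
  have sol: "riccati_ivp_solution A B Q R S \<theta>hat" for S
    unfolding assms(7)
  proof (rule riccati_ivp_solution_explicit[OF Q])
    show "lam1 = 0 \<and> lam2 = 0 \<or> (\<forall>t. lam2 * exp (lam1 * t) - lam1 * exp (lam2 * t) \<noteq> 0)"
    proof (cases "A \<noteq> 0 \<or> Q \<noteq> 0")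
      case True
      then show ?thesis using D by (metis less_irrefl)
    next
      case False
      then show ?thesis using s2 by (simp add: lam)
    qed
  qed (use assms lam in auto)
  have are: "algebraic_riccati A B Q R (lam1 * R / B\<^sup>2)"
  proof -
    have "lam1\<^sup>2 = 2 * A * lam1 + Q * B\<^sup>2 / R"
      using s2 by (simp add: lam power2_eq_square algebra_simps)
    moreover have "riccati_rhs A B Q R (lam1 * R / B\<^sup>2) = R / B\<^sup>2 * (- lam1\<^sup>2 + 2 * A * lam1 + Q * B\<^sup>2 / R)"
      using assms(2,3) by (simp add: riccati_rhs_def power2_eq_square field_simps)
    ultimately show ?thesis by (simp add: algebraic_riccati_def)
  qed
  have lim: "((\<lambda>(S, \<tau>). \<Theta> S \<tau>) \<longlongrightarrow> l) long_horizon"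
    if "\<forall>S>0. riccati_ivp_solution A B Q R S (\<Theta> S)" "(\<theta>hat \<longlongrightarrow> l) at_top" for \<Theta> l
  proof (rule tendsto_long_horizon[OF that(2)])
    fix S t :: real assume "0 \<le> t" "t < S"
    then show "\<Theta> S t = \<theta>hat t"
      using that(1) by (intro riccati_ivp_solution_unique[OF _ sol, of S]) auto
  qed
  \<comment> \<open>The factor \<open>lam1 * lam2\<close> vanishes, so \<theta>hat is identically
    0.\<close>
  have lim_Q0: "(\<theta>hat \<longlongrightarrow> 0) at_top" if "Q = 0"
  proof -
    have "lam1 * lam2 = 0" using prod that by simp
    then show ?thesis unfolding assms(7) by (simp only: mult_zero_right mult_zero_left tendsto_const)
  qed
  have lim_Q: "(\<theta>hat \<longlongrightarrow> lam1 * R / B\<^sup>2) at_top" if "Q \<noteq> 0"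
  proof -
    have "lam2 \<noteq> 0" using that prod assms(2,3) by auto
    with riccati_explicit_tendsto[of lam2 lam1 "R / B\<^sup>2"] s_pos that show ?thesis
      by (simp add: lam assms(7))
  qed
  \<comment> \<open>Here the square root is -A, so the limit 0 coincides with
    \<open>lam1 * R / B\<^sup>2\<close>.\<close>
  have lam1_Q0: "lam1 = 0" if "Q = 0" "\<not> 0 < A"
    using that by (simp add: assms(5))
  have opt: "characterizes_infinite_horizon_optimum A B Q R (lam1 * R / B\<^sup>2)" if "Q \<noteq> 0"
  proof (rule characterizes_infinite_horizon_optimum_pos[OF _ assms(2) _ are])
    \<comment> \<open>The right-hand side is lam1 = A + s, so the closed-loop rate is -s.\<close>
    show "A < B\<^sup>2 / R * (lam1 * R / B\<^sup>2)" using s_pos that assms(2,3) by (simp add: lam)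
  qed (use that assms lam_sign in auto)
  have inf: "\<exists>\<theta>inf. (\<theta>hat \<longlongrightarrow> \<theta>inf) at_top \<and> algebraic_riccati A B Q R \<theta>inf \<and>
      characterizes_infinite_horizon_optimum A B Q R \<theta>inf"
  proof (cases "Q = 0")
    case True
    then show ?thesis using lim_Q0 characterizes_infinite_horizon_optimum_zero
      by (intro exI[of _ 0]) (auto simp: algebraic_riccati_def riccati_rhs_def)
  next
    case False
    then show ?thesis using lim_Q are opt by blast
  qed
  have lim_lam1: "(\<theta>hat \<longlongrightarrow> lam1 * R / B\<^sup>2) at_top" if "\<not> (Q = 0 \<and> A > 0)"
    using that lim_Q lim_Q0 lam1_Q0 by (cases "Q = 0") auto
  show ?thesis
  proof (intro conjI allI impI ballI)
    fix \<theta> \<tau> assume "riccati_ivp_solution A B Q R T \<theta>" "\<tau> \<in> {0..T}"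
    then show "\<theta> \<tau> = \<theta>hat \<tau>" by (rule riccati_ivp_solution_unique[OF _ sol])
  next
    fix \<tau> assume "A \<noteq> 0 \<or> Q \<noteq> 0"
    then show "lam2 * exp (lam1 * \<tau>) - lam1 * exp (lam2 * \<tau>) \<noteq> 0"
      using D[of \<tau>] by linarith
  next
    fix \<Theta> assume \<Theta>: "\<forall>S>0. riccati_ivp_solution A B Q R S (\<Theta> S)"
    show "((\<lambda>(S, \<tau>). \<Theta> S \<tau>) \<longlongrightarrow> lam1 * R / B\<^sup>2) long_horizon" if "\<not> (Q = 0 \<and> A > 0)"
      using \<Theta> lim_lam1[OF that] by (rule lim)
    obtain l where "(\<theta>hat \<longlongrightarrow> l) at_top" and l: "algebraic_riccati A B Q R l"
      "characterizes_infinite_horizon_optimum A B Q R l"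
      using inf by blast
    with lim[OF \<Theta>] show "\<exists>\<theta>inf. ((\<lambda>(S, \<tau>). \<Theta> S \<tau>) \<longlongrightarrow> \<theta>inf) long_horizon \<and>
        algebraic_riccati A B Q R \<theta>inf \<and> characterizes_infinite_horizon_optimum A B Q R \<theta>inf"
      by (intro exI[of _ l] conjI)
  qed (fact sol are)+
qed

end
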